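(* Let $n\in\mathbb{N}$ and let $\mathbf{y}=(y_1,y_2,\ldots,y_n)\in\mathbb{N}^n$ be strictly increasing. Then $\mathsf{PA}^{\mathrm{inv}}_n(\mathbf{y})=\{(1^n)\}$.
   Context: $\mathbb{N}=\{1,2,3,\ldots\}$ and $[k]=\{1,\ldots,k\}$. Let $\mathbf{y}=(y_1,\ldots,y_n)\in\mathbb{N}^n$ be car lengths and $m=\sum_{i=1}^n y_i$. A one-way street has spots $1,\ldots,m$, initially empty. Given preferences $\mathbf{x}=(x_1,\ldots,x_n)\in[m]^n$, cars $1,\ldots,n$ enter in this order; car $i$ parks in spots $j,j+1,\ldots,j+y_i-1$, where $j\ge x_i$ is the smallest integer such that $j+y_i-1\le m$ and all these spots are unoccupied; if no such $j$ exists, parking fails. If all cars park, $\mathbf{x}$ is a parking assortment for $\mathbf{y}$; $\mathsf{PA}_n(\mathbf{y})$ is the set of these. $\mathsf{PA}^{\mathrm{inv}}_n(\mathbf{y})$ is the set of (permutation) invariant parking assortments: those $\mathbf{x}\in\mathsf{PA}_n(\mathbf{y})$ all of whose rearrangements are also in $\mathsf{PA}_n(\mathbf{y})$ (with $\mathbf{y}$ fixed). $(1^n)$ denotes the list of $n$ ones. *)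

theory Defs
  imports Main "HOL-Library.Multiset"
begin

text \<open>
  Tuples in \<open>\<nat>\<^sup>n\<close> are lists of length \<open>n\<close>; spots are the natural numbers \<open>1, \<dots>, m\<close>.
  A car of length \<open>l\<close> parked from spot \<open>j\<close> on occupies \<open>{j..<j + l}\<close>.
\<close>

text \<open>
  The bound \<open>j + l \<le> m + 1\<close> is \<open>j + l - 1 \<le> m\<close> without truncated subtraction.
\<close>

definition can_park :: "nat \<Rightarrow> nat set \<Rightarrow> nat \<Rightarrow> nat \<Rightarrow> nat \<Rightarrow> bool" where
  "can_park m occ l p j \<longleftrightarrow> p \<le> j \<and> j + l \<le> m + 1 \<and> {j..<j + l} \<inter> occ = {}"

text \<open>
  \<open>all_park m occ y x\<close>: on a street with \<open>m\<close> spots of which those in \<open>occ\<close> are taken, the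
  cars with lengths \<open>y\<close> and preferences \<open>x\<close>, entering in list order, all park.
\<close>

fun all_park :: "nat \<Rightarrow> nat set \<Rightarrow> nat list \<Rightarrow> nat list \<Rightarrow> bool" where
  "all_park m occ [] [] \<longleftrightarrow> True"
| "all_park m occ (l # y) (p # x) \<longleftrightarrow>
     (\<exists>j. can_park m occ l p j) \<and>
     (let j = (LEAST j. can_park m occ l p j) in all_park m (occ \<union> {j..<j + l}) y x)"
| "all_park m occ _ _ \<longleftrightarrow> False"

definition PA :: "nat list \<Rightarrow> nat list set" where
  "PA y = {x. length x = length y \<and> set x \<subseteq> {1..sum_list y} \<and> all_park (sum_list y) {} y x}"

definition PA_inv :: "nat list \<Rightarrow> nat list set" where
  "PA_inv y = {x \<in> PA y. \<forall>x'. mset x' = mset x \<longrightarrow> x' \<in> PA y}"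

end

theory Submission
  imports Defs
begin

text \<open>
  Suppose \<open>x\<close> is invariant and \<open>v\<close> is the least entry of \<open>x\<close> other than \<open>1\<close>. Let \<open>i\<close> be maximal,
  at most the number of ones in \<open>x\<close>, with \<open>y\<^sub>1 + \<dots> + y\<^sub>i < v - 1\<close>, and rearrange \<open>x\<close> to
  \<open>(1\<^sup>i, v, 1, \<dots>, 1, \<dots>)\<close>. Car \<open>i + 1\<close> parks at \<open>v\<close> and leaves a nonempty gap that ends in
  spot \<open>v - 1\<close>. If all ones are used up, then no later car prefers a spot before \<open>v\<close>;
  otherwise the gap has length at most \<open>y\<^sub>i\<^sub>+\<^sub>1\<close>, and all later cars are longer than that. So spot
  \<open>v - 1\<close> stays empty, while a parking assortment fills the whole street.
\<close>

text \<open>A nonempty block contains its first spot \<open>j\<close>, so avoiding the prefix forces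
  \<open>j\<close> past it; a preference of at most \<open>s + 1\<close> then adds no
  constraint.\<close>

lemma can_park_prefix_iff:
  assumes "1 \<le> l" "1 \<le> p" "p \<le> s + 1"
  shows "can_park m {1..s} l p j \<longleftrightarrow> s + 1 \<le> j \<and> j + l \<le> m + 1"
proof
  assume cp: "can_park m {1..s} l p j"
  then have "j \<in> {j..<j + l}" "{j..<j + l} \<inter> {1..s} = {}" "p \<le> j"
    using assms by (auto simp: can_park_def)
  then have "j \<notin> {1..s}" by blast
  with cp \<open>p \<le> j\<close> assms show "s + 1 \<le> j \<and> j + l \<le> m + 1"
    by (auto simp: can_park_def)
qed (use assms in \<open>auto simp: can_park_def\<close>)

text \<open>Each car preferring spot 1 parks directly behind the occupied prefix, so the street
  keeps the form \<open>{1..s}\<close>. The prefix grows, hence the induction for arbitrary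
  \<open>s\<close>.\<close>

lemma all_park_replicate_1_append:
  assumes "\<forall>l\<in>set y. 1 \<le> l" "s + sum_list y \<le> m"
  shows "all_park m {1..s} (y @ y') (replicate (length y) 1 @ x')
    \<longleftrightarrow> all_park m {1..s + sum_list y} y' x'"
  using assms
proof (induction y arbitrary: s)
  case (Cons l y)
  have cp: "can_park m {1..s} l 1 j \<longleftrightarrow> s + 1 \<le> j \<and> j + l \<le> m + 1" for j
    using Cons.prems by (intro can_park_prefix_iff) auto
  have "can_park m {1..s} l 1 (s + 1)"
    using Cons.prems by (subst cp) simp
  moreover have "(LEAST j. can_park m {1..s} l 1 j) = s + 1"
    unfolding cp using Cons.prems by (intro Least_equality) auto
  moreover have "{1..s} \<union> {s + 1..<s + 1 + l} = {1..s + l}" by auto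
  ultimately have "all_park m {1..s} ((l # y) @ y') (replicate (length (l # y)) 1 @ x')
    \<longleftrightarrow> all_park m {1..s + l} (y @ y') (replicate (length y) 1 @ x')"
    by (auto simp: Let_def)
  also have "\<dots> \<longleftrightarrow> all_park m {1..s + l + sum_list y} y' x'"
    using Cons.prems by (intro Cons.IH) auto
  finally show ?case by (simp add: add.assoc)
qed simp

text \<open>The lengths add up to the number of free spots, so each free spot \<open>b\<close> is
  covered in the end. Only disjointness from the initial \<open>occ\<close> is recorded for the
  covering block.\<close>

lemma all_park_fills_street:
  assumes "all_park m occ y x" "occ \<subseteq> {1..m}" "card occ + sum_list y = m"
    and "\<forall>p\<in>set x. 1 \<le> p" "b \<in> {1..m}" "b \<notin> occ"
  shows "\<exists>(l, p)\<in>set (zip y x). \<exists>j\<ge>p. {j..<j + l} \<inter> occ = {} \<and> b \<in> {j..<j + l}"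
  using assms
proof (induction m occ y x rule: all_park.induct)
  case (1 m occ)
  then have "occ = {1..m}" by (intro card_subset_eq) auto
  with 1 show ?case by simp
next
  case (2 m occ l y p x)
  define j where "j = (LEAST j. can_park m occ l p j)"
  have cp: "can_park m occ l p j"
    using "2.prems"(1) by (auto simp: j_def intro: LeastI)
  show ?case
  proof (cases "b \<in> {j..<j + l}")
    case True
    then show ?thesis using cp by (auto simp: can_park_def)
  next
    case False
    have "finite occ" using "2.prems"(2) finite_subset by blast
    then have "card (occ \<union> {j..<j + l}) = card occ + l"
      using cp by (subst card_Un_disjoint) (auto simp: can_park_def)
    moreover have "occ \<union> {j..<j + l} \<subseteq> {1..m}"
      using cp "2.prems"(2,4) by (auto simp: can_park_def)
    ultimately have "\<exists>(l', p')\<in>set (zip y x). \<exists>k\<ge>p'.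
        {k..<k + l'} \<inter> (occ \<union> {j..<j + l}) = {} \<and> b \<in> {k..<k + l'}"
      using "2.prems" False by (intro "2.IH") (auto simp: j_def Let_def)
    \<comment> \<open>The block found for the enlarged occupied set also avoids the smaller
      \<open>occ\<close>.\<close>
    then show ?thesis by fastforce
  qed
qed auto

text \<open>The street ends up full, so a later car covers \<open>v - 1\<close>. Its block starts
  after the prefix and ends before the car at \<open>v\<close>; hence its length is at most
  \<open>v - 1 - s\<close> and its preference is below \<open>v\<close>, which \<open>later\<close>
  excludes.\<close>

lemma gap_before_first_non_one:
  assumes park: "all_park m {1..s} (l # y) (v # x)"
    and pos: "1 \<le> l" "\<forall>p\<in>set x. 1 \<le> p"
    and gap: "s + 1 < v"
    and total: "s + l + sum_list y = m"
    and later: "\<And>l' p. (l', p) \<in> set (zip y x) \<Longrightarrow> p < v \<Longrightarrow> v \<le> s + l'"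
  shows False
proof -
  from park obtain j where j: "can_park m {1..s} l v j" by auto
  \<comment> \<open>All spots from \<open>v\<close> on are free, and some \<open>j\<close> at or
    after \<open>v\<close> leaves enough room, so \<open>v\<close> does too.\<close>
  have "can_park m {1..s} l v v"
    using j gap by (auto simp: can_park_def)
  moreover from this have "(LEAST j. can_park m {1..s} l v j) = v"
    by (intro Least_equality) (auto simp: can_park_def)
  ultimately have park': "all_park m ({1..s} \<union> {v..<v + l}) y x" and vl: "v + l \<le> m + 1"
    using park by (simp_all add: Let_def can_park_def[of _ _ _ v v])
  have card: "card ({1..s} \<union> {v..<v + l}) = s + l"
    using gap by (subst card_Un_disjoint) auto
  have "\<exists>(l', p)\<in>set (zip y x). \<exists>k\<ge>p.
      {k..<k + l'} \<inter> ({1..s} \<union> {v..<v + l}) = {} \<and> v - 1 \<in> {k..<k + l'}"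
    by (rule all_park_fills_street[OF park']) (use card total pos gap vl in auto)
  then obtain l' p k where lp: "(l', p) \<in> set (zip y x)" "p \<le> k"
    and disj: "{k..<k + l'} \<inter> ({1..s} \<union> {v..<v + l}) = {}" and b: "v - 1 \<in> {k..<k + l'}"
    by auto
  have "p \<in> set x" using lp(1) by (rule set_zip_rightD)
  then have "1 \<le> k" using pos lp(2) by fastforce
  have "v \<notin> {k..<k + l'}" using disj pos by auto
  then have "k + l' \<le> v" using b gap by auto
  moreover have "s < k"
  proof (rule ccontr)
    \<comment> \<open>A block reaching from \<open>k\<close> to \<open>v - 1\<close> would contain
      \<open>s\<close>; \<open>1 \<le> k\<close> excludes the case of an empty prefix.\<close>
    assume "\<not> s < k"
    then have "s \<in> {k..<k + l'}" "s \<in> {1..s}" using b gap \<open>1 \<le> k\<close> by auto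
    then show False using disj by blast
  qed
  moreover have "v \<le> s + l'" using later lp b gap by fastforce
  ultimately show False by simp
qed

lemma PA_inv_eq_replicate_1:
  assumes x: "x \<in> PA_inv y" and sorted: "sorted_wrt (<) y" and pos: "\<forall>l\<in>set y. 1 \<le> l"
  shows "x = replicate (length y) 1"
proof -
  have len: "length x = length y" and rng: "set x \<subseteq> {1..sum_list y}"
    and rearr: "\<And>x'. mset x' = mset x \<Longrightarrow> x' \<in> PA y"
    using x by (auto simp: PA_inv_def PA_def)
  have "\<forall>p\<in>set x. p = 1"
  proof (rule ccontr)
    assume ne: "\<not> (\<forall>p\<in>set x. p = 1)"
    define v where "v = Min (set x - {1})"
    have v: "v \<in> set x - {1}" unfolding v_def using ne by (intro Min_in) auto
    have v_le: "v \<le> p" if "p \<in> set x" "p \<noteq> 1" for p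
      unfolding v_def using that by (intro Min_le) auto
    have "2 \<le> v" using v rng by fastforce
    define k where "k = count (mset x) 1"
    define rest where "rest = remove1 v (filter (\<lambda>p. p \<noteq> 1) x)"
    have mset_x: "mset x = replicate_mset k 1 + add_mset v (mset rest)"
    proof -
      have "mset x = filter_mset (\<lambda>p. p = 1) (mset x) + filter_mset (\<lambda>p. p \<noteq> 1) (mset x)"
        by (rule multiset_partition)
      also have "filter_mset (\<lambda>p. p = 1) (mset x) = replicate_mset k 1"
        unfolding k_def by (rule filter_eq_replicate_mset)
      also have "filter_mset (\<lambda>p. p \<noteq> 1) (mset x) = add_mset v (mset rest)"
        using v by (simp add: rest_def)
      finally show ?thesis .
    qed
    have "k < length y"
      \<comment> \<open>The entry \<open>v\<close> is not among the \<open>k\<close> ones, so a car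
        is left to receive it.\<close>
      using arg_cong[OF mset_x, of size] len by simp
    define i where "i = (GREATEST i. i \<le> k \<and> sum_list (take i y) + 1 < v)"
    have i: "i \<le> k \<and> sum_list (take i y) + 1 < v"
      \<comment> \<open>The value 0 qualifies because \<open>v\<close> is at least 2.\<close>
      unfolding i_def by (rule GreatestI_nat[of _ 0 k]) (use \<open>2 \<le> v\<close> in auto)
    have i_max: "i' \<le> i" if "i' \<le> k" "sum_list (take i' y) + 1 < v" for i'
      unfolding i_def by (rule Greatest_le_nat[of _ _ k]) (use that in auto)
    have "i < length y" using i \<open>k < length y\<close> by simp
    define x' where "x' = replicate (k - i) 1 @ rest"
    have mset_x': "mset (replicate i 1 @ v # x') = mset x"
    proof -
      have "replicate_mset k (1::nat) = replicate_mset i 1 + replicate_mset (k - i) 1"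
        using i by (intro multiset_eqI) simp
      then show ?thesis by (simp add: mset_x x'_def)
    qed
    then have park: "all_park (sum_list y) {} y (replicate i 1 @ v # x')"
      using rearr by (simp add: PA_def)
    have y_split: "y = take i y @ y ! i # drop (Suc i) y"
      using \<open>i < length y\<close> by (rule id_take_nth_drop)
    have total: "sum_list (take i y) + y ! i + sum_list (drop (Suc i) y) = sum_list y"
      by (subst (4) y_split) simp
    have pos': "\<forall>l\<in>set (take i y). 1 \<le> l"
      using pos by (auto dest: in_set_takeD)
    have park': "all_park (sum_list y) {1..sum_list (take i y)}
        (y ! i # drop (Suc i) y) (v # x')"
    proof -
      \<comment> \<open>The empty street is written \<open>{1..0}\<close> to fit the prefix lemma
        with \<open>s = 0\<close>.\<close>
      have "all_park (sum_list y) {1..0} (take i y @ y ! i # drop (Suc i) y)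
          (replicate (length (take i y)) 1 @ v # x')"
        using park y_split \<open>i < length y\<close> by simp
      then show ?thesis
        using all_park_replicate_1_append[of "take i y" 0] pos' total by simp
    qed
    have "set x' \<subseteq> set x"
      using arg_cong[OF mset_x', of set_mset] by auto
    show False
    proof (rule gap_before_first_non_one[OF park'])
      show "1 \<le> y ! i" using pos \<open>i < length y\<close> by simp
      show "\<forall>p\<in>set x'. 1 \<le> p" using \<open>set x' \<subseteq> set x\<close> rng by fastforce
      show "sum_list (take i y) + 1 < v" using i by simp
      show "sum_list (take i y) + y ! i + sum_list (drop (Suc i) y) = sum_list y" by (fact total)
      \<comment> \<open>By minimality of \<open>v\<close>, such a preference is a 1 left over, so
        \<open>i < k\<close>. Then \<open>Suc i\<close> respects the bound \<open>k\<close>, and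
        maximality of \<open>i\<close> limits the gap to \<open>y ! i\<close>, which is less than
        \<open>l\<close>.\<close>
      fix l p assume lp: "(l, p) \<in> set (zip (drop (Suc i) y) x')" and "p < v"
      have "p \<in> set x'" using lp by (rule set_zip_rightD)
      with v_le[of p] \<open>p < v\<close> \<open>set x' \<subseteq> set x\<close> have "p = 1" by auto
      moreover have "1 \<notin> set rest" unfolding rest_def by (intro notin_set_remove1) simp
      ultimately have "i < k" using \<open>p \<in> set x'\<close> by (auto simp: x'_def)
      then have "v \<le> sum_list (take (Suc i) y) + 1"
        using i_max[of "Suc i"] by fastforce
      then have "v \<le> sum_list (take i y) + y ! i + 1"
        using \<open>i < length y\<close> by (simp add: take_Suc_conv_app_nth)
      moreover have "y ! i < l"
      proof -
        have "l \<in> set (drop (Suc i) y)" using lp by (rule set_zip_leftD)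
        moreover have "sorted_wrt (<) (take i y @ y ! i # drop (Suc i) y)"
          using sorted y_split by simp
        ultimately show ?thesis by (simp add: sorted_wrt_append)
      qed
      ultimately show "v \<le> sum_list (take i y) + l" by simp
    qed
  qed
  then show ?thesis using len by (intro replicate_eqI) auto
qed

lemma replicate_1_in_PA_inv:
  assumes "\<forall>l\<in>set y. 1 \<le> l"
  shows "replicate (length y) 1 \<in> PA_inv y"
proof -
  have "all_park (sum_list y) {} y (replicate (length y) 1)"
    using all_park_replicate_1_append[of y 0 "sum_list y" "[]" "[]"] assms by simp
  \<comment> \<open>This makes 1 an admissible preference; for empty \<open>y\<close> there is no
    preference to check.\<close>
  moreover have "1 \<le> sum_list y" if "y \<noteq> []"
    using that assms by (cases y) auto
  ultimately have "replicate (length y) 1 \<in> PA y" by (auto simp: PA_def)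
  moreover have "x' = replicate (length y) 1"
    if "mset x' = mset (replicate (length y) (1::nat))" for x'
    using mset_eq_length[OF that] mset_eq_setD[OF that]
    by (intro replicate_eqI) (auto split: if_splits)
  ultimately show ?thesis unfolding PA_inv_def by blast
qed

theorem theorem4p9:
  fixes n :: nat and y :: "nat list"
  assumes "n \<ge> 1"
    and "length y = n"
    and "\<forall>i<n. y ! i \<ge> 1"
    and "\<forall>i j. i < j \<longrightarrow> j < n \<longrightarrow> y ! i < y ! j"
  shows "PA_inv y = {replicate n 1}"
proof -
  have "sorted_wrt (<) y" using assms by (simp add: sorted_wrt_iff_nth_less)
  moreover have "\<forall>l\<in>set y. 1 \<le> l" using assms by (auto simp: in_set_conv_nth)
  ultimately show ?thesis
    using PA_inv_eq_replicate_1 replicate_1_in_PA_inv \<open>length y = n\<close> by blast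
qed

end
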